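(* Let $\alpha,c,\varepsilon>0$ be fixed. If $G$ is an $f$-expander graph on $n$ vertices, where $f(u)=\omega(1)$ for every $u=o(n)$, and $f\geq c$, and $\widehat{G}$ is the random graph obtained from $G$ by deleting every vertex independently with probability $p=n^{-\alpha}$, then w.h.p. $\widehat{G}$ is a $(c-\varepsilon)$-expander.
   Context: Graphs are finite and simple. For $U\subseteq V(H)$, $N_H(U)=\{v\notin U: v\text{ has a neighbor in }U\}$. A graph $H$ on $m$ vertices is an $f$-expander, for $f:\{1,\dots,\lfloor m/2\rfloor\}\to\mathbb{R}^+$, if every nonempty set $U$ of at most $m/2$ vertices satisfies $|N_H(U)|\ge f(|U|)\cdot|U|$; it is a $\beta$-expander ($\beta$ constant) if $|N_H(U)|\ge\beta|U|$ for every such $U$. $f\ge c$ means $f(a)\ge c$ for all $a$ in the domain of $f$. Deletion process: each vertex of $G$ is deleted independently with probability $n^{-\alpha}$; $\widehat{G}$ is the subgraph of $G$ induced by the non-deleted vertices (and it is an expander with respect to its own number of vertices). Asymptotics are as $n\to\infty$: the statement is about every family $\{G_n\}$ of graphs ($G_n$ on $n$ vertices, $G_n$ an $f_n$-expander) satisfying the hypotheses with $\alpha,c,\varepsilon$ fixed. The condition "$f(u)=\omega(1)$ for every $u=o(n)$" means that for every sequence $u=u_n\geq 1$ with $u_n/n\to 0$ one has $f_n(u_n)\to\infty$. An event holds w.h.p. if its probability tends to $1$ as $n\to\infty$. *)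

theory Defs
  imports "HOL-Probability.Product_PMF" "Graph_Theory.Digraph_Component"
begin

text \<open>
  Finite simple graphs are represented by the locale \<^locale>\<open>graph\<close> of the AFP entry Graph-Theory:
  finite, loop-free, symmetric digraphs without multiple arcs, an edge being a pair of
  opposite arcs.
\<close>

definition neighborhood :: "('a, 'b) pre_digraph \<Rightarrow> 'a set \<Rightarrow> 'a set" where
  "neighborhood H U = {v \<in> verts H - U. \<exists>u \<in> U. v \<rightarrow>\<^bsub>H\<^esub> u}"

text \<open>Only the values of \<open>f\<close> on \<open>{1..card (verts H) div 2}\<close> matter.\<close>

definition f_expander :: "(nat \<Rightarrow> real) \<Rightarrow> ('a, 'b) pre_digraph \<Rightarrow> bool" where
  "f_expander f H \<longleftrightarrow>
     (\<forall>a \<in> {1..card (verts H) div 2}. f a > 0) \<and>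
     (\<forall>U \<subseteq> verts H. U \<noteq> {} \<longrightarrow> real (card U) \<le> real (card (verts H)) / 2 \<longrightarrow>
        real (card (neighborhood H U)) \<ge> f (card U) * real (card U))"

text \<open>The constant \<open>\<beta>\<close> is not required to be positive; for \<open>\<beta> \<le> 0\<close> the property is void.\<close>

definition beta_expander :: "real \<Rightarrow> ('a, 'b) pre_digraph \<Rightarrow> bool" where
  "beta_expander \<beta> H \<longleftrightarrow>
     (\<forall>U \<subseteq> verts H. U \<noteq> {} \<longrightarrow> real (card U) \<le> real (card (verts H)) / 2 \<longrightarrow>
        real (card (neighborhood H U)) \<ge> \<beta> * real (card U))"

text \<open>
  In the product distribution below, \<open>X v\<close> is the event that \<open>v\<close> is deleted; the argument
  \<^const>\<open>False\<close> is only the dummy value of \<open>X\<close> outside the vertex set.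
\<close>

definition vertex_deletion :: "('a, 'b) pre_digraph \<Rightarrow> real \<Rightarrow> ('a, 'b) pre_digraph pmf" where
  "vertex_deletion G p =
     map_pmf (\<lambda>X. G \<restriction> {v \<in> verts G. \<not> X v}) (Pi_pmf (verts G) False (\<lambda>_. bernoulli_pmf p))"

end

theory Submission
  imports Defs
begin

text \<open>
  Let \<open>D\<close> be the set of deleted vertices. A set \<open>U\<close> of survivors has the neighbourhood
  \<open>N\<^sub>G(U) - D\<close> in the surviving graph, so \<open>U\<close> can fail to expand only if \<open>D\<close> removes too much
  of \<open>N\<^sub>G(U)\<close>. The two regimes of \<open>|U|\<close> have different reasons for this to be unlikely.

  If \<open>|U| > \<delta>n\<close>, all of \<open>D\<close> is negligible: \<open>|D|\<close> has mean \<open>n\<^sup>1\<^sup>-\<^sup>\<alpha>\<close>, so \<open>|D| < \<epsilon>\<delta>n < \<epsilon>|U|\<close> with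
  high probability by Markov's inequality, and \<open>|N\<^sub>G(U)| \<ge> c|U|\<close> loses at most \<open>\<epsilon>|U|\<close>.

  If \<open>|U| \<le> \<delta>n\<close>, then \<open>|N\<^sub>G(U)| \<ge> K|U|\<close> for a constant \<open>K = C + L\<close> as large as desired, where
  \<open>C \<ge> c\<close>. For \<open>U\<close> to fail, more than \<open>L|U|\<close> among \<open>K|U|\<close> fixed neighbours must be deleted,
  which has probability at most \<open>2\<^bsup>K|U|\<^esup> p\<^bsup>L|U|\<^esup> = q\<^bsup>|U|\<^esup>\<close> with \<open>q = 2\<^sup>K p\<^sup>L\<close>. The union bound over
  all nonempty \<open>U\<close> gives \<open>(1 + q)\<^sup>n - 1 \<le> exp (nq) - 1\<close>. As \<open>p = n\<^sup>-\<^sup>\<alpha>\<close>, choosing \<open>L \<ge> 2/\<alpha>\<close> makes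
  \<open>nq \<le> 2\<^sup>K/n\<close>, so this tends to \<open>0\<close>.

  The estimate for one graph, with both error terms, is \<open>prob_survivors_not_beta_expander_le\<close>; the
  constant \<open>\<delta>\<close> for a given \<open>K\<close> comes from \<open>small_sets_expand_uniformly\<close>.
\<close>

section \<open>Uniform expansion of small sets\<close>

text \<open>
  The hypothesis on sequences \<open>u\<^sub>n = o(n)\<close> yields one \<open>\<delta>\<close> that works for all \<open>u \<le> \<delta>n\<close> at once.
  Otherwise, for every \<open>k\<close> there are arbitrarily large \<open>n\<close> with a bad \<open>u \<le> n / (k + 1)\<close>. Placing
  such values along an increasing sequence of indices, and \<open>1\<close> elsewhere, gives a sequence that
  is \<open>o(n)\<close> and on which \<open>f\<close> does not tend to infinity.
\<close>
lemma small_sets_expand_uniformly: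
  fixes f :: "nat \<Rightarrow> nat \<Rightarrow> real"
  assumes seq: "\<And>u :: nat \<Rightarrow> nat. (\<And>n. u n \<ge> 1) \<Longrightarrow> (\<lambda>n. real (u n) / real n) \<longlonglongrightarrow> 0
           \<Longrightarrow> filterlim (\<lambda>n. f n (u n)) at_top sequentially"
  obtains \<delta> where "\<delta> > 0"
    and "\<forall>\<^sub>F n in sequentially. \<forall>u\<ge>1. real u \<le> \<delta> * real n \<longrightarrow> K \<le> f n u"
proof (rule ccontr)
  define bad where "bad k n u \<longleftrightarrow> 1 \<le> u \<and> real u \<le> real n / real (Suc k) \<and> f n u < K"
    for k n u :: nat
  assume "\<not> thesis"
  have many: "\<exists>n>N. \<exists>u. bad k n u" for k N
  proof (rule ccontr)
    assume "\<not> ?thesis"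
    then have "\<forall>n>N. \<forall>u\<ge>1. real u \<le> real n / real (Suc k) \<longrightarrow> K \<le> f n u"
      unfolding bad_def by (meson not_less)
    then have "\<forall>\<^sub>F n in sequentially. \<forall>u\<ge>1. real u \<le> 1 / real (Suc k) * real n \<longrightarrow> K \<le> f n u"
      by (intro eventually_mono[OF eventually_gt_at_top[of N]]) simp
    with that[of "1 / real (Suc k)"] \<open>\<not> thesis\<close> show False
      by simp
  qed
  have "\<exists>r. \<forall>k. (\<exists>u. bad k (r k) u) \<and> r k < r (Suc k)"
    using many by (intro dependent_nat_choice) blast+
  then obtain r where r: "\<exists>u. bad k (r k) u" and "r k < r (Suc k)" for k
    by blast
  then have mono: "strict_mono r"
    by (simp add: strict_mono_Suc_iff)
  from r obtain w where w: "bad k (r k) (w k)" for k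
    by metis
  define u where "u n = (if n \<in> range r then w (inv r n) else 1)" for n
  have u_r: "u (r k) = w k" for k
    using strict_mono_imp_inj_on[OF mono] by (simp add: u_def)
  have pos: "u n \<ge> 1" for n
    using w by (auto simp: u_def bad_def)
  have "(\<lambda>n. real (u n) / real n) \<longlonglongrightarrow> 0"
  proof (rule LIMSEQ_I)
    fix e :: real assume "e > 0"
    then obtain k0 where k0: "1 / real (Suc k0) < e"
      using nat_approx_posE by blast
    show "\<exists>N. \<forall>n\<ge>N. norm (real (u n) / real n - 0) < e"
    proof (intro exI allI impI)
      fix n assume n: "n \<ge> max (r k0) (Suc k0)"
      have "real (u n) / real n \<le> 1 / real (Suc k0)"
      proof (cases "n \<in> range r")
        case True
        then obtain k where k: "n = r k" by blast
        with n have "k0 \<le> k"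
          using strict_mono_less_eq[OF mono] by simp
        have "real (u n) / real n \<le> 1 / real (Suc k)"
          using w[of k] n by (simp add: k u_r bad_def field_simps)
        also have "\<dots> \<le> 1 / real (Suc k0)"
          using \<open>k0 \<le> k\<close> by (simp add: frac_le)
        finally show ?thesis .
      next
        case False
        then show ?thesis using n by (simp add: u_def field_simps)
      qed
      with k0 show "norm (real (u n) / real n - 0) < e" by simp
    qed
  qed
  from seq[OF pos this] have "\<forall>\<^sub>F n in sequentially. K \<le> f n (u n)"
    by (simp add: filterlim_at_top)
  then obtain N where "K \<le> f (r N) (u (r N))"
    using seq_suble[OF mono] unfolding eventually_sequentially by blast
  with w[of N] show False
    by (simp add: u_r bad_def)
qed

section \<open>Deletions in a random set\<close>

abbreviation random_subset :: "'a set \<Rightarrow> real \<Rightarrow> ('a \<Rightarrow> bool) pmf" where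
  "random_subset V p \<equiv> Pi_pmf V False (\<lambda>_. bernoulli_pmf p)"

lemma prob_all_deleted:
  assumes "finite V" "T \<subseteq> V" "0 \<le> p" "p \<le> 1"
  shows "measure_pmf.prob (random_subset V p) {X. \<forall>v\<in>T. X v} = p ^ card T"
proof -
  have "{X. \<forall>v\<in>T. X v} = Pi V (\<lambda>v. if v \<in> T then {True} else UNIV)"
    using assms by (auto simp: Pi_def split: if_splits)
  then have "measure_pmf.prob (random_subset V p) {X. \<forall>v\<in>T. X v} =
      (\<Prod>v\<in>V. measure_pmf.prob (bernoulli_pmf p) (if v \<in> T then {True} else UNIV))"
    using assms by (simp add: measure_Pi_pmf_Pi)
  also have "\<dots> = (\<Prod>v\<in>V. if v \<in> T then p else 1)"
    using assms by (intro prod.cong) (auto simp: measure_pmf_single)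
  also have "\<dots> = p ^ card T"
    using assms by (simp flip: prod.inter_restrict add: Int_absorb1)
  finally show ?thesis .
qed

lemma prob_many_deleted_le:
  assumes "finite V" "0 \<le> p" "p \<le> 1" "t > 0"
  shows "measure_pmf.prob (random_subset V p) {X. t \<le> real (card {v \<in> V. X v})}
           \<le> real (card V) * p / t"
proof -
  let ?P = "random_subset V p"
  have card: "real (card {v \<in> V. X v}) = (\<Sum>v\<in>V. indicator {X. X v} X)" for X
    using assms(1) by (simp add: indicator_def sum.If_cases Int_def)
  have int: "integrable ?P (indicator {X. X v} :: _ \<Rightarrow> real)" for v
    by (rule measure_pmf.integrable_const_bound[of _ 1]) auto
  have "measure_pmf.prob ?P {X \<in> space ?P. t \<le> real (card {v \<in> V. X v})}
          \<le> measure_pmf.expectation ?P (\<lambda>X. real (card {v \<in> V. X v})) / t"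
    unfolding card using assms int
    by (intro integral_Markov_inequality_measure[where A = "{}"]) (auto intro!: sum_nonneg)
  also have "measure_pmf.expectation ?P (\<lambda>X. real (card {v \<in> V. X v}))
               = (\<Sum>v\<in>V. measure_pmf.prob ?P {X. X v})"
    unfolding card using int by (subst Bochner_Integration.integral_sum) auto
  also have "\<dots> = (\<Sum>v\<in>V. p)"
    using assms prob_all_deleted[of V "{v}" p for v] by (intro sum.cong) auto
  finally show ?thesis by simp
qed

text \<open>
  If fewer than \<open>Cu\<close> of the \<open>(C + L)u\<close> vertices survive, some \<open>Lu\<close> of them are all deleted.
  The number of choices for these is bounded crudely by the number of all subsets of \<open>S\<close>; being
  exponential in \<open>u\<close>, it is harmless against a large power of \<open>p\<close>.
\<close>
lemma prob_few_survivors_le: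
  assumes "finite V" "S \<subseteq> V" "card S = (C + L) * u" "0 \<le> p" "p \<le> 1"
  shows "measure_pmf.prob (random_subset V p) {X. card {v \<in> S. \<not> X v} < C * u}
           \<le> (2 ^ (C + L) * p ^ L) ^ u"
proof -
  let ?P = "random_subset V p"
  define \<T> where "\<T> = {T. T \<subseteq> S \<and> card T = L * u}"
  have fin: "finite S"
    using assms finite_subset by blast
  then have fin\<T>: "finite \<T>"
    by (simp add: \<T>_def)
  have "{X. card {v \<in> S. \<not> X v} < C * u} \<subseteq> (\<Union>T\<in>\<T>. {X. \<forall>v\<in>T. X v})"
  proof
    fix X assume "X \<in> {X. card {v \<in> S. \<not> X v} < C * u}"
    moreover have "card S = card {v \<in> S. X v} + card {v \<in> S. \<not> X v}"
      using fin by (subst card_Un_disjoint[symmetric]) (auto intro: arg_cong[where f = card])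
    ultimately have "L * u \<le> card {v \<in> S. X v}"
      using assms(3) by (simp add: algebra_simps)
    then obtain T where "T \<subseteq> {v \<in> S. X v}" "card T = L * u"
      by (meson obtain_subset_with_card_n)
    then show "X \<in> (\<Union>T\<in>\<T>. {X. \<forall>v\<in>T. X v})"
      by (auto simp: \<T>_def)
  qed
  then have "measure_pmf.prob ?P {X. card {v \<in> S. \<not> X v} < C * u}
               \<le> measure_pmf.prob ?P (\<Union>T\<in>\<T>. {X. \<forall>v\<in>T. X v})"
    by (intro measure_pmf.finite_measure_mono) auto
  also have "\<dots> \<le> (\<Sum>T\<in>\<T>. measure_pmf.prob ?P {X. \<forall>v\<in>T. X v})"
    using fin\<T> by (intro measure_pmf.finite_measure_subadditive_finite) auto
  also have "\<dots> = (\<Sum>T\<in>\<T>. p ^ (L * u))"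
    using assms by (intro sum.cong refl, subst prob_all_deleted) (auto simp: \<T>_def)
  also have "\<dots> \<le> 2 ^ card S * p ^ (L * u)"
  proof -
    have "card \<T> \<le> card (Pow S)"
      using fin by (intro card_mono) (auto simp: \<T>_def)
    then have "real (card \<T>) \<le> 2 ^ card S"
      using fin by (simp add: card_Pow flip: of_nat_le_iff)
    then show ?thesis
      using assms by (simp add: mult_right_mono)
  qed
  also have "\<dots> = (2 ^ (C + L) * p ^ L) ^ u"
    by (simp add: assms(3) power_mult power_mult_distrib)
  finally show ?thesis .
qed

lemma sum_power_card_nonempty_subsets:
  fixes q :: real
  assumes "finite V"
  shows "(\<Sum>U\<in>Pow V - {{}}. q ^ card U) = (1 + q) ^ card V - 1"
proof -
  have "(1 + q) ^ card V = (\<Prod>v\<in>V. q + 1)"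
    by (simp add: add.commute)
  also have "\<dots> = (\<Sum>U\<in>Pow V. q ^ card U)"
    using assms by (subst prod_add) auto
  finally show ?thesis
    using assms by (simp add: sum_diff)
qed

text \<open>
  Union bound. The factor \<open>q\<^bsup>|U|\<^esup>\<close> for each \<open>U\<close> turns the sum over all nonempty subsets into a
  binomial sum, which needs no separate count of the sets of each size.
\<close>
lemma prob_some_small_set_fails_le:
  assumes "finite V" "0 \<le> p" "p \<le> 1" "\<U> \<subseteq> Pow V - {{}}"
    and S: "\<And>U. U \<in> \<U> \<Longrightarrow> S U \<subseteq> V \<and> (C + L) * card U \<le> card (S U)"
  shows "measure_pmf.prob (random_subset V p)
            {X. \<exists>U\<in>\<U>. card {v \<in> S U. \<not> X v} < C * card U}
           \<le> exp (real (card V) * (2 ^ (C + L) * p ^ L)) - 1"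
proof -
  let ?P = "random_subset V p"
  let ?q = "2 ^ (C + L) * p ^ L"
  have q: "0 \<le> ?q" using assms by simp
  have fin\<U>: "finite \<U>"
    using assms(1,4) finite_subset by blast
  \<comment> \<open>The number of subsets of \<open>S U\<close> would be unbounded in terms of \<open>card U\<close>, so each \<open>S U\<close> is first cut down to the
    minimal size; this can only reduce the number of survivors in it.\<close>
  have "\<exists>S'. S' \<subseteq> S U \<and> card S' = (C + L) * card U" if "U \<in> \<U>" for U
    using S[OF that] by (meson obtain_subset_with_card_n)
  then obtain S' where S': "\<And>U. U \<in> \<U> \<Longrightarrow> S' U \<subseteq> S U \<and> card (S' U) = (C + L) * card U"
    by metis
  have "{X. \<exists>U\<in>\<U>. card {v \<in> S U. \<not> X v} < C * card U}
          \<subseteq> (\<Union>U\<in>\<U>. {X. card {v \<in> S' U. \<not> X v} < C * card U})"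
  proof safe
    fix X U assume *: "U \<in> \<U>" "card {v \<in> S U. \<not> X v} < C * card U"
    have "finite (S U)"
      using S[OF *(1)] assms(1) finite_subset by blast
    then have "card {v \<in> S' U. \<not> X v} \<le> card {v \<in> S U. \<not> X v}"
      using S'[OF *(1)] by (intro card_mono) auto
    with * show "X \<in> (\<Union>U\<in>\<U>. {X. card {v \<in> S' U. \<not> X v} < C * card U})"
      by force
  qed
  then have "measure_pmf.prob ?P {X. \<exists>U\<in>\<U>. card {v \<in> S U. \<not> X v} < C * card U}
      \<le> measure_pmf.prob ?P (\<Union>U\<in>\<U>. {X. card {v \<in> S' U. \<not> X v} < C * card U})"
    by (intro measure_pmf.finite_measure_mono) auto
  also have "\<dots> \<le> (\<Sum>U\<in>\<U>. measure_pmf.prob ?P {X. card {v \<in> S' U. \<not> X v} < C * card U})"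
    using fin\<U> by (intro measure_pmf.finite_measure_subadditive_finite) auto
  also have "\<dots> \<le> (\<Sum>U\<in>\<U>. ?q ^ card U)"
  proof (rule sum_mono)
    fix U assume "U \<in> \<U>"
    then show "measure_pmf.prob ?P {X. card {v \<in> S' U. \<not> X v} < C * card U} \<le> ?q ^ card U"
      using S S' assms(1-3) by (intro prob_few_survivors_le) blast+
  qed
  also have "\<dots> \<le> (\<Sum>U\<in>Pow V - {{}}. ?q ^ card U)"
    using assms q by (intro sum_mono2) auto
  also have "\<dots> = (1 + ?q) ^ card V - 1"
    using assms by (intro sum_power_card_nonempty_subsets)
  also have "\<dots> \<le> exp ?q ^ card V - 1"
    using q by (simp add: power_mono)
  also have "\<dots> = exp (real (card V) * ?q) - 1"
    by (simp add: exp_of_nat_mult)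
  finally show ?thesis .
qed

section \<open>Expansion of the surviving graph\<close>

lemma neighborhood_induce_subgraph:
  assumes "U \<subseteq> W" "W \<subseteq> verts H"
  shows "neighborhood (H \<restriction> W) U = neighborhood H U \<inter> W"
  using assms by (fastforce simp: neighborhood_def arcs_ends_def arc_to_ends_def)

text \<open>
  The deterministic part: for sets of more than \<open>\<delta>n\<close> vertices it is enough that few vertices
  are deleted in total, so a condition on individual neighbourhoods remains only for small sets.
\<close>
lemma beta_expander_survivors:
  fixes G :: "('a, 'b) pre_digraph"
  assumes fin: "finite (verts G)"
    and exp: "f_expander f G"
    and c: "\<And>a. a \<in> {1..card (verts G) div 2} \<Longrightarrow> f a \<ge> c"
    and few: "real (card {v \<in> verts G. X v}) < \<epsilon> * \<delta> * real (card (verts G))"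
    and small: "\<And>U. U \<subseteq> verts G \<Longrightarrow> U \<noteq> {} \<Longrightarrow> real (card U) \<le> \<delta> * real (card (verts G)) \<Longrightarrow>
        real (card U) \<le> real (card (verts G)) / 2 \<Longrightarrow>
        (c - \<epsilon>) * real (card U) \<le> real (card {v \<in> neighborhood G U. \<not> X v})"
    and "\<epsilon> > 0"
  shows "beta_expander (c - \<epsilon>) (G \<restriction> {v \<in> verts G. \<not> X v})"
  unfolding beta_expander_def
proof (intro allI impI)
  let ?W = "{v \<in> verts G. \<not> X v}"
  fix U assume U: "U \<subseteq> verts (G \<restriction> ?W)" "U \<noteq> {}"
    and half: "real (card U) \<le> real (card (verts (G \<restriction> ?W))) / 2"
  have UV: "U \<subseteq> verts G" using U by auto
  have nbh: "neighborhood (G \<restriction> ?W) U = {v \<in> neighborhood G U. \<not> X v}"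
    using U by (subst neighborhood_induce_subgraph) (auto simp: neighborhood_def)
  have "card ?W \<le> card (verts G)"
    using fin by (intro card_mono) auto
  with half have half': "real (card U) \<le> real (card (verts G)) / 2"
    by simp
  show "(c - \<epsilon>) * real (card U) \<le> real (card (neighborhood (G \<restriction> ?W) U))"
  proof (cases "real (card U) \<le> \<delta> * real (card (verts G))")
    case True
    then show ?thesis using small UV U(2) half' nbh by simp
  next
    case False
    have finN: "finite (neighborhood G U)"
      using fin by (simp add: neighborhood_def)
    have "card U > 0"
      using UV U(2) fin finite_subset card_gt_0_iff by blast
    with half' have "c * real (card U) \<le> f (card U) * real (card U)"
      by (intro mult_right_mono c) auto
    also have "\<dots> \<le> real (card (neighborhood G U))"
      using exp UV U(2) half' by (simp add: f_expander_def)
    also have "card (neighborhood G U)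
        = card {v \<in> neighborhood G U. \<not> X v} + card {v \<in> neighborhood G U. X v}"
      using finN by (subst card_Un_disjoint[symmetric]) (auto intro: arg_cong[where f = card])
    also have "card {v \<in> neighborhood G U. X v} \<le> card {v \<in> verts G. X v}"
      using fin by (intro card_mono) (auto simp: neighborhood_def)
    finally have "c * real (card U) \<le> real (card {v \<in> neighborhood G U. \<not> X v})
        + real (card {v \<in> verts G. X v})" by simp
    moreover have "\<epsilon> * (\<delta> * real (card (verts G))) \<le> \<epsilon> * real (card U)"
      using False \<open>\<epsilon> > 0\<close> by (intro mult_left_mono) auto
    ultimately show ?thesis
      using few unfolding nbh by (simp add: algebra_simps)
  qed
qed

lemma prob_survivors_not_beta_expander_le:
  fixes G :: "('a, 'b) pre_digraph"
  assumes fin: "finite (verts G)" and ne: "verts G \<noteq> {}"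
    and exp: "f_expander f G"
    and c: "\<And>a. a \<in> {1..card (verts G) div 2} \<Longrightarrow> f a \<ge> c"
    and small: "\<And>u. u \<ge> 1 \<Longrightarrow> real u \<le> \<delta> * real (card (verts G)) \<Longrightarrow> real (C + L) \<le> f u"
    and "c \<le> real C" "\<epsilon> > 0" "\<delta> > 0" "0 \<le> p" "p \<le> 1"
  shows "measure_pmf.prob (vertex_deletion G p) {H. \<not> beta_expander (c - \<epsilon>) H}
    \<le> p / (\<epsilon> * \<delta>) + (exp (real (card (verts G)) * (2 ^ (C + L) * p ^ L)) - 1)"
proof -
  let ?n = "real (card (verts G))"
  let ?P = "random_subset (verts G) p"
  define \<U> where "\<U> = {U. U \<subseteq> verts G \<and> U \<noteq> {} \<and> real (card U) \<le> \<delta> * ?n \<and> real (card U) \<le> ?n / 2}"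
  \<comment> \<open>\<open>A\<close> is the failure event for large sets, \<open>B\<close> the one for small sets.\<close>
  define A where "A = {X. \<epsilon> * \<delta> * ?n \<le> real (card {v \<in> verts G. X v})}"
  define B where "B = {X. \<exists>U\<in>\<U>. card {v \<in> neighborhood G U. \<not> X v} < C * card U}"
  have n: "?n > 0" using fin ne by (simp add: card_gt_0_iff)
  have "beta_expander (c - \<epsilon>) (G \<restriction> {v \<in> verts G. \<not> X v})" if X: "X \<notin> A" "X \<notin> B" for X
  proof (rule beta_expander_survivors[OF fin exp c])
    show "real (card {v \<in> verts G. X v}) < \<epsilon> * \<delta> * ?n"
      using X(1) by (simp add: A_def)
    fix U assume U: "U \<subseteq> verts G" "U \<noteq> {}" "real (card U) \<le> \<delta> * ?n" "real (card U) \<le> ?n / 2"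
    have "(c - \<epsilon>) * real (card U) \<le> real C * real (card U)"
      using assms(6,7) by (intro mult_right_mono) auto
    also have "\<dots> \<le> real (card {v \<in> neighborhood G U. \<not> X v})"
      using X(2) U by (auto simp: B_def \<U>_def not_less simp flip: of_nat_mult)
    finally show "(c - \<epsilon>) * real (card U) \<le> real (card {v \<in> neighborhood G U. \<not> X v})" .
  qed (use assms in auto)
  then have "{X. \<not> beta_expander (c - \<epsilon>) (G \<restriction> {v \<in> verts G. \<not> X v})} \<subseteq> A \<union> B"
    by blast
  then have "measure_pmf.prob (vertex_deletion G p) {H. \<not> beta_expander (c - \<epsilon>) H}
      \<le> measure_pmf.prob ?P (A \<union> B)"
    by (simp add: vertex_deletion_def vimage_def measure_pmf.finite_measure_mono)
  also have "\<dots> \<le> measure_pmf.prob ?P A + measure_pmf.prob ?P B"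
    by (rule measure_subadditive) auto
  also have "measure_pmf.prob ?P A \<le> ?n * p / (\<epsilon> * \<delta> * ?n)"
    unfolding A_def using assms n by (intro prob_many_deleted_le) auto
  also have "?n * p / (\<epsilon> * \<delta> * ?n) = p / (\<epsilon> * \<delta>)"
    using n by simp
  also have "measure_pmf.prob ?P B \<le> exp (?n * (2 ^ (C + L) * p ^ L)) - 1"
    unfolding B_def
  proof (rule prob_some_small_set_fails_le)
    fix U assume U: "U \<in> \<U>"
    then have "card U \<ge> 1"
      using fin finite_subset by (auto simp: \<U>_def Suc_le_eq card_gt_0_iff)
    with U have "real (C + L) * real (card U) \<le> f (card U) * real (card U)"
      by (intro mult_right_mono small) (auto simp: \<U>_def)
    also have "\<dots> \<le> real (card (neighborhood G U))"
      using U exp by (simp add: \<U>_def f_expander_def)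
    finally have "(C + L) * card U \<le> card (neighborhood G U)"
      by (simp only: of_nat_le_iff flip: of_nat_mult)
    then show "neighborhood G U \<subseteq> verts G \<and> (C + L) * card U \<le> card (neighborhood G U)"
      by (auto simp: neighborhood_def)
  qed (use assms in \<open>auto simp: \<U>_def\<close>)
  finally show ?thesis by simp
qed

theorem theorem4p1:
  fixes \<alpha> c \<epsilon> :: real
    and G :: "nat \<Rightarrow> ('a, 'b) pre_digraph"
    and f :: "nat \<Rightarrow> nat \<Rightarrow> real"
  assumes "\<alpha> > 0" and "c > 0" and "\<epsilon> > 0"
    and "\<And>n. graph (G n)"
    and "\<And>n. card (verts (G n)) = n"
    and "\<And>n. f_expander (f n) (G n)"
    and "\<And>u :: nat \<Rightarrow> nat. (\<And>n. u n \<ge> 1) \<Longrightarrow> (\<lambda>n. real (u n) / real n) \<longlonglongrightarrow> 0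
           \<Longrightarrow> filterlim (\<lambda>n. f n (u n)) at_top sequentially"
    and "\<And>n a. a \<in> {1..n div 2} \<Longrightarrow> f n a \<ge> c"
  shows "(\<lambda>n. measure_pmf.prob (vertex_deletion (G n) (real n powr - \<alpha>))
            {H. beta_expander (c - \<epsilon>) H}) \<longlonglongrightarrow> 1"
proof -
  \<comment> \<open>\<open>L\<close> makes \<open>p ^ L \<le> 1 / n\<^sup>2\<close>: one factor \<open>1 / n\<close> pays for the union bound over all vertex
    sets, the other one tends to \<open>0\<close>.\<close>
  define C where "C = nat \<lceil>c\<rceil>"
  define L where "L = nat \<lceil>2 / \<alpha>\<rceil>"
  have "c \<le> real C" "2 / \<alpha> \<le> real L"
    unfolding C_def L_def by (simp_all add: real_nat_ceiling_ge)
  then have L: "2 \<le> \<alpha> * real L"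
    using \<open>\<alpha> > 0\<close> by (simp add: field_simps)
  obtain \<delta> where "\<delta> > 0"
    and small: "\<forall>\<^sub>F n in sequentially. \<forall>u\<ge>1. real u \<le> \<delta> * real n \<longrightarrow> real (C + L) \<le> f n u"
    by (rule small_sets_expand_uniformly[OF assms(7)])
  define bound where
    "bound n = 1 - (real n powr - \<alpha> / (\<epsilon> * \<delta>) + (exp (2 ^ (C + L) / real n) - 1))" for n
  have "((\<lambda>n. real n powr - \<alpha>) \<longlongrightarrow> 0) sequentially"
    using \<open>\<alpha> > 0\<close> by (intro tendsto_neg_powr filterlim_real_sequentially) auto
  then have "bound \<longlonglongrightarrow> 1 - (0 / (\<epsilon> * \<delta>) + (exp 0 - 1))"
    unfolding bound_def using \<open>\<epsilon> > 0\<close> \<open>\<delta> > 0\<close>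
    by (intro tendsto_intros lim_const_over_n) auto
  then have lim: "bound \<longlonglongrightarrow> 1"
    by simp
  have "\<forall>\<^sub>F n in sequentially. bound n \<le>
      measure_pmf.prob (vertex_deletion (G n) (real n powr - \<alpha>)) {H. beta_expander (c - \<epsilon>) H}"
    using small eventually_gt_at_top[of 0]
  proof eventually_elim
    case (elim n)
    let ?p = "real n powr - \<alpha>"
    interpret graph "G n" by fact
    have "verts (G n) \<noteq> {}"
      using elim assms(5)[of n] by auto
    have p: "0 \<le> ?p" "?p \<le> 1"
      using elim \<open>\<alpha> > 0\<close> powr_mono[of "-\<alpha>" 0 "real n"] by auto
    have "?p ^ L = real n powr (- \<alpha> * real L)"
      using elim by (simp add: powr_powr flip: powr_realpow)
    also have "\<dots> \<le> real n powr - 2"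
      using L elim by (intro powr_mono) auto
    also have "\<dots> = 1 / (real n * real n)"
      using elim by (simp add: powr_minus powr_numeral power2_eq_square divide_simps)
    finally have "real n * (2 ^ (C + L) * ?p ^ L) \<le> real n * (2 ^ (C + L) * (1 / (real n * real n)))"
      by (intro mult_left_mono) auto
    also have "\<dots> = 2 ^ (C + L) / real n"
      using elim by simp
    finally have q: "real n * (2 ^ (C + L) * ?p ^ L) \<le> 2 ^ (C + L) / real n" .
    have "measure_pmf.prob (vertex_deletion (G n) ?p) {H. \<not> beta_expander (c - \<epsilon>) H}
        \<le> ?p / (\<epsilon> * \<delta>) + (exp (real (card (verts (G n))) * (2 ^ (C + L) * ?p ^ L)) - 1)"
      using elim assms p \<open>\<delta> > 0\<close> \<open>c \<le> real C\<close> \<open>verts (G n) \<noteq> {}\<close>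
      by (intro prob_survivors_not_beta_expander_le[where f = "f n"]) auto
    also have "\<dots> \<le> 1 - bound n"
      using q by (simp add: bound_def assms(5))
    finally show ?case
      using measure_pmf.prob_compl[of "{H. beta_expander (c - \<epsilon>) H}" "vertex_deletion (G n) ?p"]
      by (simp add: Compl_eq_Diff_UNIV[symmetric] Collect_neg_eq)
  qed
  then show ?thesis
    by (rule tendsto_sandwich[OF _ _ lim tendsto_const]) simp
qed

end
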